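(* Let $N_0,t_0$ be integers with $1\le t_0\le N_0$ and let $\alpha=\frac{\log t_0}{\log N_0}$. Let $C_2>0$ and $0<\beta<\alpha<1$. There is $N_*$ depending on $C_2,\alpha,\beta$ such that if $N=N_0^n\ge N_*$ (with $n$ a positive integer and $t=t_0^n$), then the sets $A_j$ in the Cantor-type construction with parameters $N,t$ can be chosen so that the resulting measure $\sigma$ satisfies $$|\widehat{\sigma}(k)|\le C_2|k|^{-\beta/2}\quad\text{for all integers }k\ne0 .$$
   Context: Cantor-type construction. Let $N=N_0^n$, $t=t_0^n$, so $\alpha=\frac{\log t}{\log N}$, and put $K=2^N$, $M_j=KN^j$, $T_j=Kt^j$ ($j\ge0$). Let $A_0=\{0,\frac1K,\dots,\frac{K-1}{K}\}$ and $A_{j+1}=\bigcup_{a\in A_j}A_{j+1,a}$, where for each $a\in A_j$ the set $A_{j+1,a}$ is a subset of $\{a,a+\frac{1}{M_{j+1}},\dots,a+\frac{N-1}{M_{j+1}}\}$ with $\#A_{j+1,a}=t$; thus $\#A_j=T_j$. "The sets $A_j$ can be chosen" means that the subsets $A_{j+1,a}$ can be so chosen. The measure $\sigma$ is the weak limit of the absolutely continuous probability measures with densities $\phi_j=\sum_{a\in A_j}T_j^{-1}M_j\mathbf{1}_{[a,a+M_j^{-1}]}$; it is a probability measure supported on $E=\bigcap_{j\ge1}\bigcup_{a\in A_j}[a,a+M_j^{-1}]$. $\widehat{\sigma}(k)=\int_0^1e^{-2\pi ikx}\,d\sigma(x)$. *)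

theory Defs
  imports "HOL-Probability.Probability"
begin

text \<open>The base scale is \<open>K = 2 ^ N\<close>. Below, \<open>B j a\<close> stands for the set \<open>A\<^sub>j\<^sub>,\<^sub>a\<close> of points of
  generation \<open>j \<ge> 1\<close> chosen below the point \<open>a\<close> of generation \<open>j - 1\<close>; the values \<open>B 0 a\<close>, and
  \<open>B j a\<close> for other \<open>a\<close>, are irrelevant.\<close>

definition cantor_M :: "nat \<Rightarrow> nat \<Rightarrow> nat" where
  "cantor_M N j = 2 ^ N * N ^ j"

definition cantor_T :: "nat \<Rightarrow> nat \<Rightarrow> nat \<Rightarrow> nat" where
  "cantor_T N t j = 2 ^ N * t ^ j"

primrec cantor_A :: "nat \<Rightarrow> (nat \<Rightarrow> real \<Rightarrow> real set) \<Rightarrow> nat \<Rightarrow> real set" where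
  "cantor_A N B 0 = {real i / real (2 ^ N) | i. i < 2 ^ N}"
| "cantor_A N B (Suc j) = (\<Union>a\<in>cantor_A N B j. B (Suc j) a)"

definition cantor_choice :: "nat \<Rightarrow> nat \<Rightarrow> (nat \<Rightarrow> real \<Rightarrow> real set) \<Rightarrow> bool" where
  "cantor_choice N t B \<longleftrightarrow>
     (\<forall>j. \<forall>a\<in>cantor_A N B j.
        B (Suc j) a \<subseteq> {a + real i / real (cantor_M N (Suc j)) | i. i < N} \<and>
        card (B (Suc j) a) = t)"

definition cantor_density :: "nat \<Rightarrow> nat \<Rightarrow> (nat \<Rightarrow> real \<Rightarrow> real set) \<Rightarrow> nat \<Rightarrow> real \<Rightarrow> real" where
  "cantor_density N t B j x =
     (\<Sum>a\<in>cantor_A N B j. inverse (real (cantor_T N t j)) * real (cantor_M N j)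
        * indicator {a..a + inverse (real (cantor_M N j))} x)"

definition is_cantor_measure ::
    "nat \<Rightarrow> nat \<Rightarrow> (nat \<Rightarrow> real \<Rightarrow> real set) \<Rightarrow> real measure \<Rightarrow> bool" where
  "is_cantor_measure N t B \<sigma> \<longleftrightarrow>
     real_distribution \<sigma> \<and>
     weak_conv_m (\<lambda>j. density lborel (\<lambda>x. ennreal (cantor_density N t B j x))) \<sigma>"

definition fourier_coeff :: "real measure \<Rightarrow> int \<Rightarrow> complex" where
  "fourier_coeff \<sigma> k =
     (LINT x:{0..1}|\<sigma>. exp (- 2 * complex_of_real pi * \<i> * of_int k * complex_of_real x))"

text \<open>The predicate determines \<open>\<sigma>\<close> uniquely, so it pins down \<^emph>\<open>the\<close> measure of the construction.\<close>

lemma is_cantor_measure_unique: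
  assumes "is_cantor_measure N t B \<sigma>" "is_cantor_measure N t B \<tau>"
  shows "\<sigma> = \<tau>"
proof -
  interpret s: real_distribution \<sigma> using assms(1) by (simp add: is_cantor_measure_def)
  interpret t: real_distribution \<tau> using assms(2) by (simp add: is_cantor_measure_def)
  let ?F = "\<lambda>j. cdf (density lborel (\<lambda>x. ennreal (cantor_density N t B j x)))"
  let ?D = "{x. \<not> isCont (cdf \<sigma>) x} \<union> {x. \<not> isCont (cdf \<tau>) x}"
  have count: "countable ?D"
    using s.countable_atoms t.countable_atoms by (simp add: s.isCont_cdf t.isCont_cdf zero_less_measure_iff)
  have eq: "cdf \<sigma> x = cdf \<tau> x" if "x \<notin> ?D" for x
    using assms that unfolding is_cantor_measure_def weak_conv_m_def weak_conv_def
    by (auto intro: LIMSEQ_unique)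
  have "cdf \<sigma> x = cdf \<tau> x" for x
  proof (rule ccontr)
    assume ne: "cdf \<sigma> x \<noteq> cdf \<tau> x"
    have "((\<lambda>y. cdf \<sigma> y - cdf \<tau> y) \<longlongrightarrow> cdf \<sigma> x - cdf \<tau> x) (at_right x)"
      using s.cdf_is_right_cont[of x] t.cdf_is_right_cont[of x]
      by (auto simp: continuous_within intro!: tendsto_diff)
    then have "eventually (\<lambda>y. cdf \<sigma> y - cdf \<tau> y \<noteq> 0) (at_right x)"
      using ne by (intro tendsto_imp_eventually_ne) auto
    then obtain b where b: "b > x" "\<And>y. x < y \<Longrightarrow> y < b \<Longrightarrow> cdf \<sigma> y - cdf \<tau> y \<noteq> 0"
      by (auto simp: eventually_at_right_field)
    then have "{x<..<b} \<subseteq> ?D" using eq by force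
    then show False
      using b(1) count countable_subset uncountable_open_interval by blast
  qed
  then show ?thesis
    by (intro cdf_unique) (auto simp: s.real_distribution_axioms t.real_distribution_axioms)
qed

end

theory Submission
  imports Defs "HOL-Real_Asymp.Real_Asymp"
begin

text \<open>
  The decay comes from square-root cancellation. Let \<open>\<phi>\<^sub>j\<close> be the density of generation \<open>j\<close>. Since
  \<open>\<phi>\<^sub>0\<close> is uniform on the unit interval, its Fourier coefficients at \<open>k \<noteq> 0\<close> vanish (\<open>tree_char_0\<close>), and it
  suffices to bound the sum over \<open>j\<close> of the increments between generations \<open>j\<close> and \<open>j + 1\<close>. Each
  increment is the product of the smoothing factor of an interval of length \<open>1 / M\<^sub>j\<^sub>+\<^sub>1\<close>, which is at
  most \<open>min 1 (M\<^sub>j\<^sub>+\<^sub>1 / \<bar>k\<bar>)\<close>, and of the average over the \<open>T\<^sub>j\<close> cells of generation \<open>j\<close> of the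
  difference between the mean of \<open>exp (- 2 * \<pi> * \<i> * k * x)\<close> over the \<open>t\<close> chosen children and its
  mean over all \<open>N\<close> children (\<open>tree_char_Suc\<close>).

  If the children of every cell form a random cyclic shift of one fixed block, these differences are
  independent with mean zero, and by periodicity only \<open>M\<^sub>j\<^sub>+\<^sub>1\<close> frequencies matter. A union bound
  shows that some choice makes the averages at most a constant times
  \<open>sqrt (ln M\<^sub>j\<^sub>+\<^sub>1 / T\<^sub>j)\<close> for all \<open>k\<close> simultaneously. No probability space is set up for this: the
  shifts are picked greedily, so that the total of the exponential moments never exceeds its mean
  (\<open>greedy_exponential_moment\<close>, \<open>refinement_with_small_error\<close>, \<open>cantor_tree_with_small_errors\<close>).

  With \<open>min 1 y \<le> y powr (\<beta> / 2)\<close> the increments are at most \<open>\<bar>k\<bar> powr (- \<beta> / 2)\<close> times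
  \<open>M\<^sub>j\<^sub>+\<^sub>1 powr (\<beta> / 2) * sqrt (ln M\<^sub>j\<^sub>+\<^sub>1 / T\<^sub>j)\<close>, up to a constant. As \<open>t = N powr \<alpha>\<close> with
  \<open>\<beta> < \<alpha>\<close>, this decays geometrically in \<open>j\<close>, and as \<open>\<beta> < 1\<close>, the factor
  \<open>(2 ^ N) powr ((\<beta> - 1) / 2)\<close> coming from the base scale makes the sum as small as desired for
  large \<open>N\<close> (\<open>increment_term_le\<close>).

  The measure itself is obtained from the same formula for the increments at arbitrary real
  frequencies: there the trivial bound already makes the characteristic functions converge, and
  tightness together with Levy's continuity theorem yields the weak limit
  (\<open>weak_limit_on_unit_interval\<close>, \<open>cantor_measure_of_tree\<close>).
\<close>

section \<open>Simultaneously small sums by exponential moments\<close>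

text \<open>The linear term disappears on averaging a mean-zero variable, so this inequality bounds its
  exponential moment by a Gaussian one.\<close>

lemma exp_le_add_exp_square: "exp x \<le> x + exp (x\<^sup>2)" for x :: real
proof -
  consider "x < 0" | "0 \<le> x" "x \<le> 1" | "1 < x" by linarith
  then show ?thesis
  proof cases
    case 1
    define y where "y = - x"
    have y: "0 < y" using 1 by (simp add: y_def)
    have q: "1 + y + y\<^sup>2 / 2 \<le> exp y"
      using y exp_lower_Taylor_quadratic[of y] by simp
    have "1 \<le> (1 - y + y\<^sup>2) * (1 + y + y\<^sup>2 / 2)"
    proof -
      have "(1 - y + y\<^sup>2) * (1 + y + y\<^sup>2 / 2) = 1 + y^2 / 2 + y^3 / 2 + y^4 / 2"
        by (simp add: field_simps power2_eq_square power3_eq_cube power4_eq_xxxx)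
      then show ?thesis using y by simp
    qed
    also have "\<dots> \<le> (1 - y + y\<^sup>2) * exp y"
    proof (rule mult_left_mono[OF q])
      have "0 \<le> (1 - y)\<^sup>2 + y" using y by simp
      then show "0 \<le> 1 - y + y\<^sup>2" using y by (simp add: power2_diff)
    qed
    finally have "exp (- y) \<le> 1 - y + y\<^sup>2"
      by (simp add: exp_minus field_simps)
    moreover have "1 + y\<^sup>2 \<le> exp (y\<^sup>2)" by (rule exp_ge_add_one_self)
    ultimately have "exp (- y) \<le> - y + exp (y\<^sup>2)" by linarith
    then show ?thesis by (simp add: y_def)
  next
    case 2
    have "exp x \<le> 1 + x + x\<^sup>2" using 2 by (intro exp_bound) auto
    moreover have "1 + x\<^sup>2 \<le> exp (x\<^sup>2)" by (rule exp_ge_add_one_self)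
    ultimately show ?thesis by linarith
  next
    case 3
    have "x * 1 \<le> x * x" using 3 by (intro mult_left_mono) auto
    then have "exp x \<le> exp (x\<^sup>2)" by (simp add: power2_eq_square)
    then show ?thesis using 3 by linarith
  qed
qed

lemma sum_exp_le_of_mean_zero:
  fixes X :: "'s \<Rightarrow> real"
  assumes "finite S" "(\<Sum>s\<in>S. X s) = 0" "\<And>s. s \<in> S \<Longrightarrow> \<bar>X s\<bar> \<le> b"
  shows "(\<Sum>s\<in>S. exp (X s)) \<le> real (card S) * exp (b\<^sup>2)"
proof -
  have "exp (X s) \<le> X s + exp (b\<^sup>2)" if "s \<in> S" for s
  proof -
    have "(X s)\<^sup>2 \<le> b\<^sup>2" using assms(3)[OF that] by (metis abs_ge_zero power2_abs power_mono)
    then show ?thesis using exp_le_add_exp_square[of "X s"] by (smt (verit) exp_le_cancel_iff)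
  qed
  then have "(\<Sum>s\<in>S. exp (X s)) \<le> (\<Sum>s\<in>S. X s + exp (b\<^sup>2))" by (intro sum_mono)
  then show ?thesis using assms(2) by (simp add: sum.distrib)
qed

text \<open>The method of conditional expectations: \<open>\<sigma>\<close> is built one coordinate at a time. Choosing the next
  coordinate uniformly at random multiplies the expected total of the exponentials by at most
  \<open>exp (b\<^sup>2)\<close>, hence some value does at least as well.\<close>

lemma greedy_exponential_moment:
  fixes X :: "'f \<Rightarrow> 'a \<Rightarrow> 's \<Rightarrow> real"
  assumes "finite A" "finite S" "S \<noteq> {}"
    and "\<And>f a. f \<in> F \<Longrightarrow> a \<in> A \<Longrightarrow> (\<Sum>s\<in>S. X f a s) = 0"
    and "\<And>f a s. f \<in> F \<Longrightarrow> a \<in> A \<Longrightarrow> s \<in> S \<Longrightarrow> \<bar>X f a s\<bar> \<le> b"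
  shows "\<exists>\<sigma>. (\<forall>a\<in>A. \<sigma> a \<in> S) \<and>
    (\<Sum>f\<in>F. exp (\<Sum>a\<in>A. X f a (\<sigma> a))) \<le> real (card F) * exp (b\<^sup>2 * real (card A))"
  using assms(1,4,5)
proof (induction A rule: finite_induct)
  case empty
  then show ?case by simp
next
  case (insert a A)
  then obtain \<sigma> where \<sigma>: "\<forall>a\<in>A. \<sigma> a \<in> S"
    "(\<Sum>f\<in>F. exp (\<Sum>a\<in>A. X f a (\<sigma> a))) \<le> real (card F) * exp (b\<^sup>2 * real (card A))"
    by auto
  define w where "w f = exp (\<Sum>a\<in>A. X f a (\<sigma> a))" for f
  \<comment> \<open>Otherwise the average over \<open>s\<close> of the left-hand side would violate the bound for one mean-zero factor.\<close>
  have "\<exists>s\<in>S. (\<Sum>f\<in>F. w f * exp (X f a s)) \<le> exp (b\<^sup>2) * sum w F"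
  proof (rule ccontr)
    assume "\<not> ?thesis"
    then have "(\<Sum>s\<in>S. exp (b\<^sup>2) * sum w F) < (\<Sum>s\<in>S. \<Sum>f\<in>F. w f * exp (X f a s))"
      using assms(2,3) by (intro sum_strict_mono) auto
    also have "\<dots> = (\<Sum>f\<in>F. w f * (\<Sum>s\<in>S. exp (X f a s)))"
      by (subst sum.swap) (simp add: sum_distrib_left)
    also have "\<dots> \<le> (\<Sum>f\<in>F. w f * (real (card S) * exp (b\<^sup>2)))"
      using insert.prems assms(2)
      by (intro sum_mono mult_left_mono sum_exp_le_of_mean_zero) (auto simp: w_def)
    also have "\<dots> = (\<Sum>s\<in>S. exp (b\<^sup>2) * sum w F)"
      by (simp add: sum_distrib_left sum_distrib_right algebra_simps)
    finally show False by simp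
  qed
  then obtain s where s: "s \<in> S" "(\<Sum>f\<in>F. w f * exp (X f a s)) \<le> exp (b\<^sup>2) * sum w F"
    by blast
  have "(\<Sum>f\<in>F. exp (\<Sum>x\<in>insert a A. X f x ((\<sigma>(a := s)) x))) = (\<Sum>f\<in>F. w f * exp (X f a s))"
  proof (intro sum.cong refl)
    fix f
    have "(\<Sum>x\<in>A. X f x ((\<sigma>(a := s)) x)) = (\<Sum>a\<in>A. X f a (\<sigma> a))"
      using insert.hyps by (intro sum.cong) auto
    then show "exp (\<Sum>x\<in>insert a A. X f x ((\<sigma>(a := s)) x)) = w f * exp (X f a s)"
      using insert.hyps by (simp add: exp_add w_def)
  qed
  also have "\<dots> \<le> exp (b\<^sup>2) * (real (card F) * exp (b\<^sup>2 * real (card A)))"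
    using \<sigma>(2) by (intro order_trans[OF s(2)] mult_left_mono) (auto simp: w_def)
  also have "\<dots> = real (card F) * exp (b\<^sup>2 * real (card (insert a A)))"
    using insert.hyps by (simp add: exp_add algebra_simps)
  finally show ?case using s(1) \<sigma>(1) by (intro exI[of _ "\<sigma>(a := s)"]) auto
qed

text \<open>A deterministic form of Hoeffding's inequality with a union bound over \<open>F\<close>: each single
  exponential is at most the total of all of them, and the exponential parameter is optimised.\<close>

lemma uniformly_small_sums_choice:
  fixes X :: "'f \<Rightarrow> 'a \<Rightarrow> 's \<Rightarrow> real"
  assumes "finite A" "finite S" "S \<noteq> {}" "card F \<ge> 2" "b > 0"
    and mean: "\<And>f a. f \<in> F \<Longrightarrow> a \<in> A \<Longrightarrow> (\<Sum>s\<in>S. X f a s) = 0"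
    and bound: "\<And>f a s. f \<in> F \<Longrightarrow> a \<in> A \<Longrightarrow> s \<in> S \<Longrightarrow> \<bar>X f a s\<bar> \<le> b"
  shows "\<exists>\<sigma>. (\<forall>a\<in>A. \<sigma> a \<in> S) \<and>
    (\<forall>f\<in>F. (\<Sum>a\<in>A. X f a (\<sigma> a)) \<le> 2 * b * sqrt (real (card A) * ln (real (card F))))"
proof (cases "A = {}")
  case True
  then show ?thesis by simp
next
  case False
  define n where "n = real (card A)"
  define L where "L = ln (real (card F))"
  have n: "n > 0" using False assms(1) by (auto simp: n_def card_gt_0_iff)
  have L: "L > 0" using assms(4) by (auto simp: L_def)
  have finF: "finite F" using assms(4) by (metis card.infinite not_numeral_le_zero)
  \<comment> \<open>The value of \<open>\<theta>\<close> that minimises \<open>L / \<theta> + \<theta> * b\<^sup>2 * n\<close>.\<close>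
  define \<theta> where "\<theta> = sqrt (L / n) / b"
  have \<theta>: "\<theta> > 0" using n L assms(5) by (simp add: \<theta>_def)
  obtain \<sigma> where \<sigma>: "\<forall>a\<in>A. \<sigma> a \<in> S"
    "(\<Sum>f\<in>F. exp (\<Sum>a\<in>A. \<theta> * X f a (\<sigma> a))) \<le> real (card F) * exp ((\<theta> * b)\<^sup>2 * n)"
  proof (atomize_elim, unfold n_def, rule greedy_exponential_moment)
    fix f a assume "f \<in> F" "a \<in> A"
    then show "(\<Sum>s\<in>S. \<theta> * X f a s) = 0" using mean by (simp flip: sum_distrib_left)
    fix s assume "s \<in> S"
    then show "\<bar>\<theta> * X f a s\<bar> \<le> \<theta> * b"
      using bound \<open>f \<in> F\<close> \<open>a \<in> A\<close> \<theta> by (simp add: abs_mult)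
  qed (use assms in auto)
  have "(\<Sum>a\<in>A. X f a (\<sigma> a)) \<le> 2 * b * sqrt (n * L)" if f: "f \<in> F" for f
  proof -
    define Y where "Y = (\<Sum>a\<in>A. X f a (\<sigma> a))"
    have "exp (\<theta> * Y) \<le> (\<Sum>f\<in>F. exp (\<Sum>a\<in>A. \<theta> * X f a (\<sigma> a)))"
      unfolding Y_def sum_distrib_left
      by (rule member_le_sum[OF f]) (use finF in auto)
    also have "\<dots> \<le> exp L * exp ((\<theta> * b)\<^sup>2 * n)" using \<sigma>(2) assms(4) by (simp add: L_def)
    also have "\<dots> = exp (L + (\<theta> * b)\<^sup>2 * n)" by (simp add: exp_add)
    finally have "\<theta> * Y \<le> L + (\<theta> * b)\<^sup>2 * n" by simp
    also have "(\<theta> * b)\<^sup>2 * n = L" using assms(5) n L by (simp add: \<theta>_def)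
    also have "L + L = \<theta> * (2 * b * sqrt (n * L))"
      using n L assms(5) by (simp add: \<theta>_def real_sqrt_divide real_sqrt_mult)
    finally show ?thesis using \<theta> unfolding Y_def by simp
  qed
  then show ?thesis using \<sigma>(1) by (auto simp: n_def L_def)
qed

text \<open>A complex number is controlled by the real parts of its products with \<open>1\<close>, \<open>-1\<close>, \<open>\<i>\<close> and \<open>-\<i>\<close>;
  these four rotations turn every complex test into four real ones.\<close>

lemma uniformly_small_complex_sums_choice:
  fixes X :: "'f \<Rightarrow> 'a \<Rightarrow> 's \<Rightarrow> complex"
  assumes "finite A" "finite S" "S \<noteq> {}" "finite F" "F \<noteq> {}" "b > 0"
    and mean: "\<And>f a. f \<in> F \<Longrightarrow> a \<in> A \<Longrightarrow> (\<Sum>s\<in>S. X f a s) = 0"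
    and bound: "\<And>f a s. f \<in> F \<Longrightarrow> a \<in> A \<Longrightarrow> s \<in> S \<Longrightarrow> cmod (X f a s) \<le> b"
  shows "\<exists>\<sigma>. (\<forall>a\<in>A. \<sigma> a \<in> S) \<and>
    (\<forall>f\<in>F. cmod (\<Sum>a\<in>A. X f a (\<sigma> a)) \<le> 4 * b * sqrt (real (card A) * ln (4 * real (card F))))"
proof -
  define U :: "complex set" where "U = {1, -1, \<i>, -\<i>}"
  have U: "finite U" "card U = 4" "\<And>u. u \<in> U \<Longrightarrow> cmod u = 1"
    by (auto simp: U_def) (auto simp: complex_eq_iff)
  define R where "R = 2 * b * sqrt (real (card A) * ln (4 * real (card F)))"
  have "\<exists>\<sigma>. (\<forall>a\<in>A. \<sigma> a \<in> S) \<and>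
    (\<forall>(f,u)\<in>F \<times> U. (\<Sum>a\<in>A. Re (u * X f a (\<sigma> a)))
       \<le> 2 * b * sqrt (real (card A) * ln (real (card (F \<times> U)))))"
    unfolding case_prod_unfold
  proof (rule uniformly_small_sums_choice[where X = "\<lambda>p a s. Re (snd p * X (fst p) a s)"])
    have "card F > 0" using assms by (simp add: card_gt_0_iff)
    then show "2 \<le> card (F \<times> U)" by (simp add: U card_cartesian_product)
  next
    fix p a assume p: "p \<in> F \<times> U" and a: "a \<in> A"
    have "(\<Sum>s\<in>S. Re (snd p * X (fst p) a s)) = Re (snd p * (\<Sum>s\<in>S. X (fst p) a s))"
      by (simp only: sum_distrib_left Re_sum)
    also have "(\<Sum>s\<in>S. X (fst p) a s) = 0" using p a by (intro mean) auto
    finally show "(\<Sum>s\<in>S. Re (snd p * X (fst p) a s)) = 0" by simp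
    fix s assume s: "s \<in> S"
    have "\<bar>Re (snd p * X (fst p) a s)\<bar> \<le> cmod (snd p * X (fst p) a s)" by (rule abs_Re_le_cmod)
    also have "\<dots> \<le> b" using bound[of "fst p" a s] U p a s by (auto simp: norm_mult)
    finally show "\<bar>Re (snd p * X (fst p) a s)\<bar> \<le> b" .
  qed (use assms in auto)
  then obtain \<sigma> where \<sigma>: "\<forall>a\<in>A. \<sigma> a \<in> S"
    "\<And>f u. f \<in> F \<Longrightarrow> u \<in> U \<Longrightarrow> (\<Sum>a\<in>A. Re (u * X f a (\<sigma> a))) \<le> R"
    by (auto simp: R_def card_cartesian_product U mult.commute)
  have "cmod (\<Sum>a\<in>A. X f a (\<sigma> a)) \<le> 2 * R" if f: "f \<in> F" for f
  proof -
    define z where "z = (\<Sum>a\<in>A. X f a (\<sigma> a))"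
    have "Re (u * z) \<le> R" if "u \<in> U" for u
      using \<sigma>(2)[OF f that] by (simp only: z_def sum_distrib_left Re_sum)
    from this[of 1] this[of "-1"] this[of \<i>] this[of "-\<i>"]
    have "\<bar>Re z\<bar> \<le> R" "\<bar>Im z\<bar> \<le> R" by (auto simp: U_def)
    then show ?thesis using cmod_le[of z] unfolding z_def by linarith
  qed
  then show ?thesis using \<sigma>(1) by (intro exI[of _ \<sigma>]) (simp add: R_def mult.assoc)
qed

section \<open>One refinement step\<close>

lemma inj_on_shift_mod: "inj_on (\<lambda>s. (s + i) mod N) {..<N}" for N :: nat
proof (rule linorder_inj_onI')
  fix x y assume "x \<in> {..<N}" "y \<in> {..<N}" "x < y"
  then have "\<not> N dvd y - x" by (auto dest!: dvd_imp_le)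
  then show "(x + i) mod N \<noteq> (y + i) mod N"
    using mod_eq_dvd_iff_nat[of "x + i" "y + i" N] \<open>x < y\<close> by auto
qed

text \<open>Under a uniformly random cyclic shift every point becomes uniformly distributed. This is why
  shifting one fixed block of length \<open>t\<close> is enough randomness: the mean over the shifts of a sum over
  the block is \<open>t\<close> times the mean over all residues.\<close>

lemma sum_cyclic_shift:
  fixes g :: "nat \<Rightarrow> 'a::comm_monoid_add"
  assumes "0 < N"
  shows "(\<Sum>s<N. g ((i + s) mod N)) = (\<Sum>s<N. g s)"
proof (rule sum.reindex_bij_betw)
  have "inj_on (\<lambda>s. (s + i) mod N) {..<N}" by (rule inj_on_shift_mod)
  then have "inj_on (\<lambda>s. (i + s) mod N) {..<N}" by (simp add: add.commute)
  moreover have "(\<lambda>s. (i + s) mod N) ` {..<N} \<subseteq> {..<N}" using assms by auto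
  ultimately show "bij_betw (\<lambda>s. (i + s) mod N) {..<N} {..<N}"
    by (simp add: bij_betw_def endo_inj_surj)
qed

text \<open>Every cell \<open>m\<close> is cut into \<open>N\<close> children \<open>N * m + i\<close>, of which \<open>t\<close> are kept. Averaging a test function
  over the kept children instead of all children costs an error of mean zero and size at most \<open>2\<close> in
  each cell, independently in different cells, so square-root cancellation holds for all tests at once.\<close>

lemma refinement_with_small_error:
  fixes c :: "'f \<Rightarrow> nat \<Rightarrow> complex"
  assumes "finite I" "finite F" "F \<noteq> {}" "1 \<le> t" "t \<le> N"
    and c: "\<And>f x. cmod (c f x) \<le> 1"
  shows "\<exists>J. finite J \<and> (\<forall>x\<in>J. x div N \<in> I) \<and> (\<forall>m\<in>I. card {x\<in>J. x div N = m} = t) \<and>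
    (\<forall>f\<in>F. cmod ((\<Sum>x\<in>J. c f x) / t - (\<Sum>m\<in>I. \<Sum>i<N. c f (N * m + i)) / N)
            \<le> 8 * sqrt (real (card I) * ln (4 * real (card F))))"
proof -
  have N: "N > 0" using assms by simp
  \<comment> \<open>The error contributed by the cell \<open>m\<close> if its children are the shift by \<open>s\<close> of the block \<open>{..<t}\<close>.\<close>
  define X where "X f m s = (\<Sum>i<t. c f (N * m + (i + s) mod N)) / of_nat t
      - (\<Sum>i<N. c f (N * m + i)) / of_nat N" for f m s
  have "\<exists>\<sigma>. (\<forall>m\<in>I. \<sigma> m \<in> {..<N}) \<and>
    (\<forall>f\<in>F. cmod (\<Sum>m\<in>I. X f m (\<sigma> m)) \<le> 4 * 2 * sqrt (real (card I) * ln (4 * real (card F))))"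
  proof (rule uniformly_small_complex_sums_choice)
    show "(\<Sum>s<N. X f m s) = 0" for f m
    proof -
      have "(\<Sum>s<N. \<Sum>i<t. c f (N * m + (i + s) mod N)) = (\<Sum>i<t. \<Sum>s<N. c f (N * m + (i + s) mod N))"
        by (rule sum.swap)
      also have "\<dots> = of_nat t * (\<Sum>s<N. c f (N * m + s))"
        by (simp add: sum_cyclic_shift[OF N, of "\<lambda>s. c f (N * m + s)"])
      finally show ?thesis
        using N assms by (simp add: X_def sum_subtractf flip: sum_divide_distrib)
    qed
    show "cmod (X f m s) \<le> 2" for f m s
    proof -
      have avg: "cmod ((\<Sum>i<n. g i) / of_nat n) \<le> 1" if "n > 0" "\<And>i. cmod (g i) \<le> 1"
        for n :: nat and g :: "nat \<Rightarrow> complex"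
      proof -
        have "cmod (\<Sum>i<n. g i) \<le> of_nat (card {..<n}) * 1"
          by (rule sum_norm_bound) (use that in auto)
        then show ?thesis using that by (simp add: norm_divide)
      qed
      have "cmod (X f m s) \<le> 1 + 1"
        unfolding X_def
        by (rule order_trans[OF norm_triangle_ineq4], intro add_mono avg) (use assms N in auto)
      then show ?thesis by simp
    qed
  qed (use assms N in \<open>auto simp: lessThan_empty_iff\<close>)
  then obtain \<sigma> where \<sigma>: "\<And>m. m \<in> I \<Longrightarrow> \<sigma> m < N"
    "\<And>f. f \<in> F \<Longrightarrow> cmod (\<Sum>m\<in>I. X f m (\<sigma> m)) \<le> 8 * sqrt (real (card I) * ln (4 * real (card F)))"
    by auto
  define C where "C m = (\<lambda>i. N * m + (i + \<sigma> m) mod N) ` {..<t}" for m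
  have inj: "inj_on (\<lambda>i. N * m + (i + \<sigma> m) mod N) {..<t}" for m
    using inj_on_subset[OF inj_on_shift_mod[of "\<sigma> m" N], of "{..<t}"] assms(5)
    by (auto simp: inj_on_def)
  have div: "x div N = m" if "x \<in> C m" for x m using that N by (auto simp: C_def)
  have disj: "C i \<inter> C j = {}" if "i \<noteq> j" for i j using div that by blast
  have finC: "finite (C m)" for m by (simp add: C_def)
  define J where "J = (\<Union>m\<in>I. C m)"
  have fibre: "{x\<in>J. x div N = m} = C m" if "m \<in> I" for m
    using that div by (auto simp: J_def)
  have sumJ: "(\<Sum>x\<in>J. c f x) = (\<Sum>m\<in>I. \<Sum>i<t. c f (N * m + (i + \<sigma> m) mod N))" for f
  proof -
    have "(\<Sum>x\<in>J. c f x) = (\<Sum>m\<in>I. \<Sum>x\<in>C m. c f x)"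
      unfolding J_def
      by (rule sum.UNION_disjoint) (use assms(1) disj finC in auto)
    also have "\<dots> = (\<Sum>m\<in>I. \<Sum>i<t. c f (N * m + (i + \<sigma> m) mod N))"
      by (simp add: C_def sum.reindex[OF inj])
    finally show ?thesis .
  qed
  have "(\<Sum>x\<in>J. c f x) / t - (\<Sum>m\<in>I. \<Sum>i<N. c f (N * m + i)) / N = (\<Sum>m\<in>I. X f m (\<sigma> m))" for f
    by (simp add: sumJ X_def sum_subtractf sum_divide_distrib)
  then show ?thesis using \<sigma>(2) fibre assms div
    by (intro exI[of _ J]) (auto simp: C_def card_image inj J_def)
qed

section \<open>Integer coordinates for the Cantor construction\<close>

text \<open>A point of generation \<open>j\<close> is written as \<open>x / M\<^sub>j\<close> with a natural number \<open>x\<close>; its parent is then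
  \<open>x div N\<close>, and the sets of numerators \<open>I j\<close> describe the whole construction.\<close>

definition cantor_tree :: "nat \<Rightarrow> nat \<Rightarrow> (nat \<Rightarrow> nat set) \<Rightarrow> bool" where
  "cantor_tree N t I \<longleftrightarrow> I 0 = {..<2 ^ N} \<and>
     (\<forall>j. (\<forall>x\<in>I (Suc j). x div N \<in> I j) \<and> (\<forall>m\<in>I j. card {x\<in>I (Suc j). x div N = m} = t))"

text \<open>The choice of children encoded by a tree: those points of the next generation that lie in the half-open
  cell with left endpoint \<open>a\<close>. Cells of generation \<open>j - 1\<close> have length \<open>N / M\<^sub>j\<close>.\<close>

definition tree_choice :: "nat \<Rightarrow> (nat \<Rightarrow> nat set) \<Rightarrow> nat \<Rightarrow> real \<Rightarrow> real set" where
  "tree_choice N I j a = {y \<in> (\<lambda>x. real x / real (cantor_M N j)) ` I j.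
      a \<le> y \<and> y < a + real N / real (cantor_M N j)}"

text \<open>Up to a normalisation, the change in the exponential sum at frequency \<open>u\<close> when the children kept at
  generation \<open>j + 1\<close> replace the full set of children.\<close>

definition refinement_error :: "nat \<Rightarrow> nat \<Rightarrow> (nat \<Rightarrow> nat set) \<Rightarrow> nat \<Rightarrow> real \<Rightarrow> complex" where
  "refinement_error N t I j u =
     (\<Sum>x\<in>I (Suc j). cis (u * real x / real (cantor_M N (Suc j)))) / t -
     (\<Sum>m\<in>I j. \<Sum>i<N. cis (u * real (N * m + i) / real (cantor_M N (Suc j)))) / N"

lemma cantor_M_pos: "N > 0 \<Longrightarrow> cantor_M N j > 0"
  by (simp add: cantor_M_def)

lemma cantor_M_Suc: "cantor_M N (Suc j) = N * cantor_M N j"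
  by (simp add: cantor_M_def)

lemma cantor_T_Suc: "cantor_T N t (Suc j) = t * cantor_T N t j"
  by (simp add: cantor_T_def)

lemma cantor_tree_0: "cantor_tree N t I \<Longrightarrow> I 0 = {..<2 ^ N}"
  by (simp add: cantor_tree_def)

lemma cantor_tree_div: "cantor_tree N t I \<Longrightarrow> x \<in> I (Suc j) \<Longrightarrow> x div N \<in> I j"
  by (auto simp: cantor_tree_def)

lemma cantor_tree_fibre: "cantor_tree N t I \<Longrightarrow> m \<in> I j \<Longrightarrow> card {x\<in>I (Suc j). x div N = m} = t"
  by (auto simp: cantor_tree_def)

lemma cantor_tree_subset:
  assumes "cantor_tree N t I" "N > 0"
  shows "I j \<subseteq> {..<cantor_M N j}"
proof (induction j)
  case 0
  then show ?case using cantor_tree_0[OF assms(1)] by (simp add: cantor_M_def)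
next
  case (Suc j)
  show ?case
  proof
    fix x assume "x \<in> I (Suc j)"
    then have "x div N < cantor_M N j" using cantor_tree_div[OF assms(1)] Suc by auto
    then show "x \<in> {..<cantor_M N (Suc j)}"
      using assms(2) by (simp add: cantor_M_Suc div_less_iff_less_mult mult.commute)
  qed
qed

lemma cantor_tree_finite: "cantor_tree N t I \<Longrightarrow> N > 0 \<Longrightarrow> finite (I j)"
  by (meson cantor_tree_subset finite_lessThan finite_subset)

lemma cantor_tree_sum:
  fixes g :: "nat \<Rightarrow> 'a::comm_monoid_add"
  assumes "cantor_tree N t I" "N > 0"
  shows "(\<Sum>x\<in>I (Suc j). g x) = (\<Sum>m\<in>I j. \<Sum>x\<in>{x\<in>I (Suc j). x div N = m}. g x)"
  using assms cantor_tree_div[OF assms(1)]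
  by (intro sum.group[symmetric]) (auto intro: cantor_tree_finite)

lemma cantor_tree_card:
  assumes "cantor_tree N t I" "N > 0"
  shows "card (I j) = cantor_T N t j"
proof (induction j)
  case 0
  then show ?case using cantor_tree_0[OF assms(1)] by (simp add: cantor_T_def)
next
  case (Suc j)
  have "card (I (Suc j)) = (\<Sum>m\<in>I j. card {x\<in>I (Suc j). x div N = m})"
    using cantor_tree_sum[OF assms, of "\<lambda>_. 1::nat" j] by simp
  also have "\<dots> = card (I j) * t" by (simp add: cantor_tree_fibre[OF assms(1)])
  finally show ?case using Suc by (simp add: cantor_T_Suc)
qed

lemma tree_choice_fibre:
  assumes "N > 0"
  shows "tree_choice N I (Suc j) (real m / real (cantor_M N j)) =
    (\<lambda>x. real x / real (cantor_M N (Suc j))) ` {x\<in>I (Suc j). x div N = m}"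
proof -
  define M where "M = real (cantor_M N (Suc j))"
  have M: "M > 0" using assms by (simp add: M_def cantor_M_pos)
  have m: "real m / real (cantor_M N j) = real (N * m) / M"
    using assms by (simp add: M_def cantor_M_Suc)
  have "(real (N * m) / M \<le> real x / M \<and> real x / M < real (N * m) / M + real N / M)
      \<longleftrightarrow> x div N = m" for x
  proof -
    have "(real (N * m) / M \<le> real x / M \<and> real x / M < real (N * m) / M + real N / M)
       \<longleftrightarrow> real (N * m) \<le> real x \<and> real x < real (N * m + N)"
      using M by (simp add: divide_le_cancel divide_less_cancel flip: add_divide_distrib)
    also have "\<dots> \<longleftrightarrow> N * m \<le> x \<and> x < N * m + N"
      by (simp only: of_nat_le_iff of_nat_less_iff)
    also have "\<dots> \<longleftrightarrow> x div N = m"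
    proof
      assume "N * m \<le> x \<and> x < N * m + N"
      then show "x div N = m" by (intro div_nat_eqI) (auto simp: algebra_simps)
    next
      assume "x div N = m"
      then show "N * m \<le> x \<and> x < N * m + N"
        using assms by (metis add.commute dividend_less_times_div times_div_less_eq_dividend)
    qed
    finally show ?thesis .
  qed
  then show ?thesis unfolding tree_choice_def m M_def[symmetric] by auto
qed

lemma cantor_A_tree_choice:
  assumes "cantor_tree N t I" "N > 0"
  shows "cantor_A N (tree_choice N I) j = (\<lambda>x. real x / real (cantor_M N j)) ` I j"
proof (induction j)
  case 0
  then show ?case using cantor_tree_0[OF assms(1)] by (auto simp: cantor_M_def)
next
  case (Suc j)
  have "cantor_A N (tree_choice N I) (Suc j) =
      (\<Union>m\<in>I j. (\<lambda>x. real x / real (cantor_M N (Suc j))) ` {x\<in>I (Suc j). x div N = m})"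
    using Suc assms(2) by (simp add: tree_choice_fibre)
  also have "\<dots> = (\<lambda>x. real x / real (cantor_M N (Suc j))) ` I (Suc j)"
    using cantor_tree_div[OF assms(1), of _ j] by auto
  finally show ?case .
qed

lemma inj_on_div_cantor_M: "N > 0 \<Longrightarrow> inj_on (\<lambda>x. real x / real (cantor_M N j)) A"
  using cantor_M_pos[of N j] by (auto simp: inj_on_def)

lemma cantor_choice_tree_choice:
  assumes "cantor_tree N t I" "N > 0"
  shows "cantor_choice N t (tree_choice N I)"
  unfolding cantor_choice_def cantor_A_tree_choice[OF assms]
proof (intro allI ballI)
  fix j a assume "a \<in> (\<lambda>x. real x / real (cantor_M N j)) ` I j"
  then obtain m where m: "m \<in> I j" "a = real m / real (cantor_M N j)" by blast
  have B: "tree_choice N I (Suc j) a =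
      (\<lambda>x. real x / real (cantor_M N (Suc j))) ` {x\<in>I (Suc j). x div N = m}"
    unfolding m(2) by (rule tree_choice_fibre[OF assms(2)])
  have "tree_choice N I (Suc j) a \<subseteq> {a + real i / real (cantor_M N (Suc j)) |i. i < N}"
    unfolding B
  proof (rule image_subsetI)
    fix x assume x: "x \<in> {x\<in>I (Suc j). x div N = m}"
    have "N * m + x mod N = x" using x mult_div_mod_eq[of N x] by blast
    then have "real x = real (N * m + x mod N)" by simp
    also have "real (N * m + x mod N) / real (cantor_M N (Suc j))
        = a + real (x mod N) / real (cantor_M N (Suc j))"
      using assms(2) by (simp add: m(2) cantor_M_Suc add_divide_distrib)
    finally show "real x / real (cantor_M N (Suc j))
        \<in> {a + real i / real (cantor_M N (Suc j)) |i. i < N}"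
      using assms(2) by auto
  qed
  moreover have "card (tree_choice N I (Suc j) a) = t"
    unfolding B using assms(2) cantor_tree_fibre[OF assms(1) m(1)]
    by (subst card_image) (auto intro: inj_on_div_cantor_M)
  ultimately show "tree_choice N I (Suc j) a
      \<subseteq> {a + real i / real (cantor_M N (Suc j)) |i. i < N} \<and> card (tree_choice N I (Suc j) a) = t"
    by blast
qed

text \<open>At an integer frequency, exponential sums over \<open>\<int> / P\<close> depend only on the frequency modulo \<open>P\<close>.
  Hence finitely many tests, \<open>M\<^sub>j\<^sub>+\<^sub>1\<close> of them, cover all integer frequencies of generation \<open>j + 1\<close>.\<close>

lemma cis_rational_periodic:
  assumes "P > 0"
  shows "cis (2 * pi * real_of_int k * real x / real P)
       = cis (2 * pi * real_of_int (k mod int P) * real x / real P)"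
proof -
  have "real_of_int k = real_of_int (k mod int P) + real P * real_of_int (k div int P)"
    by (metis mod_mult_div_eq of_int_add of_int_mult of_int_of_nat_eq)
  then have "2 * pi * real_of_int k * real x / real P
      = 2 * pi * real_of_int (k mod int P) * real x / real P
        + 2 * pi * real_of_int (k div int P * int x)"
    using assms by (simp add: field_simps)
  then show ?thesis
    by (simp add: cis_multiple_2pi flip: cis_mult del: of_int_mult)
qed

lemma refinement_error_periodic:
  assumes "N > 0"
  shows "refinement_error N t I j (2 * pi * real_of_int k)
       = refinement_error N t I j (2 * pi * real_of_int (k mod int (cantor_M N (Suc j))))"
  unfolding refinement_error_def
  by (subst (1 2) cis_rational_periodic[OF cantor_M_pos[OF assms]]) (rule refl)

text \<open>The tree is grown by one refinement step after the other, each tested against all residues modulo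
  \<open>M\<^sub>j\<^sub>+\<^sub>1\<close>.\<close>

lemma cantor_tree_with_small_errors:
  assumes "1 \<le> t" "t \<le> N"
  shows "\<exists>I. cantor_tree N t I \<and>
    (\<forall>j k. cmod (refinement_error N t I j (2 * pi * real_of_int k))
       \<le> 8 * sqrt (real (cantor_T N t j) * ln (4 * real (cantor_M N (Suc j)))))"
proof -
  have N: "N > 0" using assms by simp
  define step where "step j A J \<longleftrightarrow> (\<forall>x\<in>J. x div N \<in> A) \<and> (\<forall>m\<in>A. card {x\<in>J. x div N = m} = t) \<and>
    (\<forall>k\<in>{0..<int (cantor_M N (Suc j))}.
      cmod ((\<Sum>x\<in>J. cis (2 * pi * real_of_int k * real x / real (cantor_M N (Suc j)))) / t -
        (\<Sum>m\<in>A. \<Sum>i<N. cis (2 * pi * real_of_int k * real (N * m + i) / real (cantor_M N (Suc j)))) / N)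
      \<le> 8 * sqrt (real (card A) * ln (4 * real (cantor_M N (Suc j)))))" for j A J
  have "\<exists>I. \<forall>j. (finite (I j) \<and> (j = 0 \<longrightarrow> I j = {..<2 ^ N})) \<and> step j (I j) (I (Suc j))"
  proof (rule dependent_nat_choice)
    show "\<exists>A::nat set. finite A \<and> ((0::nat) = 0 \<longrightarrow> A = {..<2 ^ N})" by auto
  next
    fix A :: "nat set" and j :: nat
    assume "finite A \<and> (j = 0 \<longrightarrow> A = {..<2 ^ N})"
    then show "\<exists>J. (finite J \<and> (Suc j = 0 \<longrightarrow> J = {..<2 ^ N})) \<and> step j A J"
      using refinement_with_small_error[of A "{0..<int (cantor_M N (Suc j))}" t N
          "\<lambda>k x. cis (2 * pi * real_of_int k * real x / real (cantor_M N (Suc j)))"]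
        assms cantor_M_pos[OF N, of "Suc j"]
      unfolding step_def by auto
  qed
  then obtain I where I: "\<And>j. j = 0 \<longrightarrow> I j = {..<2 ^ N}" "\<And>j. step j (I j) (I (Suc j))"
    by blast
  have tree: "cantor_tree N t I"
    using I unfolding cantor_tree_def step_def by simp
  have "cmod (refinement_error N t I j (2 * pi * real_of_int k))
       \<le> 8 * sqrt (real (cantor_T N t j) * ln (4 * real (cantor_M N (Suc j))))" for j k
  proof -
    have "k mod int (cantor_M N (Suc j)) \<in> {0..<int (cantor_M N (Suc j))}"
      using cantor_M_pos[OF N, of "Suc j"] by simp
    then show ?thesis
      using I(2)[of j] unfolding refinement_error_periodic[OF N, of t I j k] step_def
      unfolding refinement_error_def cantor_tree_card[OF tree N] by blast
  qed
  then show ?thesis using tree by blast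
qed

lemma cis_dist_le: "cmod (cis x - cis y) \<le> \<bar>x - y\<bar>"
proof -
  have "cis y * iexp (x - y) = cis x" by (simp only: cis_conv_exp[symmetric] cis_mult) simp
  then have "cis x - cis y = cis y * (iexp (x - y) - (\<Sum>k\<le>0. (\<i> * (x - y)) ^ k / fact k))"
    by (simp add: right_diff_distrib)
  also have "cmod \<dots> \<le> \<bar>x - y\<bar>"
    using iexp_approx1[of "x - y" 0] by (simp add: norm_mult)
  finally show ?thesis .
qed

text \<open>All children of a cell lie within the cell length \<open>1 / M\<^sub>j\<close> of its left endpoint, whichever children
  are kept. Unlike the bound from cancellation this one holds for every real frequency, which is what the
  existence of the limit measure needs.\<close>

lemma refinement_error_trivial_bound:
  assumes tree: "cantor_tree N t I" and N: "N > 0" and t: "t > 0"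
  shows "cmod (refinement_error N t I j u) \<le> 2 * \<bar>u\<bar> * real (cantor_T N t j) / real (cantor_M N j)"
proof -
  define g where "g x = cis (u * real x / real (cantor_M N (Suc j)))" for x
  define \<delta> where "\<delta> = \<bar>u\<bar> / real (cantor_M N j)"
  have near: "cmod (g x - g (N * m)) \<le> \<delta>" if "N * m \<le> x" "x \<le> N * m + N" for x m
  proof -
    have "real N * real m \<le> real x" using that(1) by (simp flip: of_nat_mult)
    then have "cmod (g x - g (N * m)) \<le> \<bar>u\<bar> * (real x - real (N * m)) / real (cantor_M N (Suc j))"
      unfolding g_def using that
      by (intro order_trans[OF cis_dist_le])
        (simp add: abs_mult flip: diff_divide_distrib right_diff_distrib of_nat_diff)
    also have "\<dots> \<le> \<bar>u\<bar> * real N / real (cantor_M N (Suc j))"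
      using of_nat_mono[OF that(2), where 'a = real]
      by (intro divide_right_mono mult_left_mono) auto
    finally show ?thesis using N by (simp add: cantor_M_Suc \<delta>_def)
  qed
  have avg: "cmod ((\<Sum>x\<in>A. g x) / real (card A) - g (N * m)) \<le> \<delta>"
    if "card A > 0" "\<And>x. x \<in> A \<Longrightarrow> N * m \<le> x \<and> x \<le> N * m + N" for A m
  proof -
    have "(\<Sum>x\<in>A. g x) / real (card A) - g (N * m) = (\<Sum>x\<in>A. g x - g (N * m)) / real (card A)"
      using that(1) by (simp add: sum_subtractf diff_divide_distrib)
    moreover have "cmod (\<Sum>x\<in>A. g x - g (N * m)) \<le> real (card A) * \<delta>"
      by (rule sum_norm_bound) (use that near in auto)
    ultimately show ?thesis using that(1) by (simp add: norm_divide field_simps)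
  qed
  have "refinement_error N t I j u =
      (\<Sum>m\<in>I j. ((\<Sum>x\<in>{x\<in>I (Suc j). x div N = m}. g x) / real t - g (N * m))
        - ((\<Sum>x\<in>(+) (N * m) ` {..<N}. g x) / real N - g (N * m)))"
    unfolding refinement_error_def g_def[symmetric] cantor_tree_sum[OF tree N]
    by (simp add: sum_subtractf sum_divide_distrib sum.reindex)
  also have "cmod \<dots> \<le> real (card (I j)) * (\<delta> + \<delta>)"
  proof (rule sum_norm_bound)
    fix m assume m: "m \<in> I j"
    have "N * m \<le> x \<and> x \<le> N * m + N" if "x div N = m" for x
      using that dividend_less_times_div[OF N, of x] times_div_less_eq_dividend[of N x] by auto
    then have "cmod ((\<Sum>x\<in>{x\<in>I (Suc j). x div N = m}. g x) / real t - g (N * m)) \<le> \<delta>"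
      using avg[of "{x\<in>I (Suc j). x div N = m}" m] t N
      unfolding cantor_tree_fibre[OF tree m] by auto
    moreover have "cmod ((\<Sum>x\<in>(+) (N * m) ` {..<N}. g x) / real N - g (N * m)) \<le> \<delta>"
    proof -
      have "card ((+) (N * m) ` {..<N}) = N" by (simp add: card_image)
      moreover have "N * m \<le> x \<and> x \<le> N * m + N" if "x \<in> (+) (N * m) ` {..<N}" for x
        using that by auto
      ultimately show ?thesis using avg[of "(+) (N * m) ` {..<N}" m] N by presburger
    qed
    ultimately show "cmod (((\<Sum>x\<in>{x\<in>I (Suc j). x div N = m}. g x) / real t - g (N * m))
        - ((\<Sum>x\<in>(+) (N * m) ` {..<N}. g x) / real N - g (N * m))) \<le> \<delta> + \<delta>"
      by (rule order_trans[OF norm_triangle_ineq4 add_mono])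
  qed
  finally show ?thesis by (simp add: cantor_tree_card[OF tree N] \<delta>_def mult_ac)
qed

section \<open>Fourier transforms of unions of equal cells\<close>

text \<open>The characteristic function of the uniform distribution on the unit interval.\<close>

definition unit_char :: "real \<Rightarrow> complex" where
  "unit_char v = (if v = 0 then 1 else (cis v - 1) / (\<i> * v))"

lemma cmod_unit_char_le_1: "cmod (unit_char v) \<le> 1"
  using cis_dist_le[of v 0] by (auto simp: unit_char_def norm_divide norm_mult)

lemma cmod_unit_char_le: "v \<noteq> 0 \<Longrightarrow> cmod (unit_char v) \<le> 2 / \<bar>v\<bar>"
  using norm_triangle_ineq4[of "cis v" 1]
  by (simp add: unit_char_def norm_divide norm_mult divide_right_mono)

text \<open>An interval of length \<open>N\<close> is a union of \<open>N\<close> unit intervals; on the Fourier side this is a geometric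
  sum.\<close>

lemma unit_char_refine:
  assumes "N > 0"
  shows "unit_char (real N * v) = unit_char v * ((\<Sum>i<N. cis (real i * v)) / N)"
proof (cases "v = 0")
  case True
  then show ?thesis using assms by (simp add: unit_char_def)
next
  case False
  have "cis (real N * v) - 1 = (cis v - 1) * (\<Sum>i<N. cis (real i * v))"
    using power_diff_1_eq[of "cis v" N] by (simp only: Complex.DeMoivre)
  then show ?thesis using False assms by (simp add: unit_char_def)
qed

lemma integral_iexp_interval:
  assumes "h > 0"
  shows "has_bochner_integral lborel (\<lambda>x. indicator {a..a + h} x *\<^sub>R iexp (u * x))
           (h * (cis (u * a) * unit_char (u * h)))"
proof -
  define F where "F x = (if u = 0 then complex_of_real x else iexp (u * x) / (\<i> * u))" for x
  have "has_bochner_integral lborel (\<lambda>x. indicator {a..a + h} x *\<^sub>R iexp (u * x)) (F (a + h) - F a)"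
  proof (rule has_bochner_integral_FTC_Icc)
    show "a \<le> a + h" using assms by simp
    show "(F has_vector_derivative iexp (u * x)) (at x within {a..a + h})" for x
    proof (cases "u = 0")
      case True
      then have "F = of_real" by (auto simp: F_def)
      then show ?thesis using True by (auto intro!: derivative_eq_intros)
    next
      case False
      then have F: "F = (\<lambda>x. iexp (u * x) / (\<i> * u))" by (auto simp: F_def)
      have "((iexp \<circ> (*) u) has_vector_derivative u *\<^sub>R (\<i> * iexp (u * x))) (at x within {a..a + h})"
        by (rule vector_diff_chain_within) (auto intro!: derivative_eq_intros)
      from has_vector_derivative_divide[OF this[unfolded o_def], of "\<i> * u"]
      show ?thesis using False unfolding F by (simp add: scaleR_conv_of_real)
    qed
    show "continuous_on {a..a + h} (\<lambda>x. iexp (u * x))" by (intro continuous_intros)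
  qed
  moreover have "F (a + h) - F a = h * (cis (u * a) * unit_char (u * h))"
  proof (cases "u = 0")
    case True
    then show ?thesis by (simp add: F_def unit_char_def)
  next
    case False
    have "iexp (u * (a + h)) = cis (u * a) * cis (u * h)"
      by (simp only: cis_conv_exp[symmetric] cis_mult distrib_left)
    moreover have "iexp (u * a) = cis (u * a)" by (simp only: cis_conv_exp)
    ultimately show ?thesis
      using False assms by (simp add: F_def unit_char_def field_simps)
  qed
  ultimately show ?thesis by simp
qed

definition cells_density :: "nat set \<Rightarrow> nat \<Rightarrow> real \<Rightarrow> real" where
  "cells_density I M x = (\<Sum>m\<in>I. inverse (real (card I)) * real M *
     indicator {real m / real M..real m / real M + inverse (real M)} x)"

lemma cells_density_nonneg: "0 \<le> cells_density I M x"
  by (auto simp: cells_density_def intro!: sum_nonneg)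

lemma cells_density_measurable [measurable]: "cells_density I M \<in> borel_measurable borel"
  unfolding cells_density_def by measurable

lemma has_integral_cells_density_iexp:
  assumes "finite I" "M > 0"
  shows "has_bochner_integral lborel (\<lambda>x. cells_density I M x *\<^sub>R iexp (u * x))
    (unit_char (u / M) * (\<Sum>m\<in>I. cis (u * real m / real M)) / card I)"
proof -
  have "has_bochner_integral lborel
     (\<lambda>x. \<Sum>m\<in>I. (inverse (real (card I)) * real M) *\<^sub>R
        (indicator {real m / real M..real m / real M + inverse (real M)} x *\<^sub>R iexp (u * x)))
     (\<Sum>m\<in>I. (inverse (real (card I)) * real M) *\<^sub>R
        (inverse (real M) * (cis (u * (real m / real M)) * unit_char (u * inverse (real M)))))"
    using assms
    by (intro has_bochner_integral_sum has_bochner_integral_scaleR_right integral_iexp_interval) auto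
  also have "(\<lambda>x. \<Sum>m\<in>I. (inverse (real (card I)) * real M) *\<^sub>R
        (indicator {real m / real M..real m / real M + inverse (real M)} x *\<^sub>R iexp (u * x)))
     = (\<lambda>x. cells_density I M x *\<^sub>R iexp (u * x))"
    by (simp add: cells_density_def scaleR_sum_left)
  also have "(\<Sum>m\<in>I. (inverse (real (card I)) * real M) *\<^sub>R
        (inverse (real M) * (cis (u * (real m / real M)) * unit_char (u * inverse (real M)))))
     = unit_char (u / M) * (\<Sum>m\<in>I. cis (u * real m / real M)) / card I"
    using assms
    by (simp add: scaleR_conv_of_real sum_distrib_left sum_divide_distrib field_simps)
  finally show ?thesis .
qed

lemma char_cells_density:
  assumes "finite I" "M > 0"
  shows "char (density lborel (\<lambda>x. ennreal (cells_density I M x))) u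
     = unit_char (u / M) * (\<Sum>m\<in>I. cis (u * real m / real M)) / card I"
proof -
  have "char (density lborel (\<lambda>x. ennreal (cells_density I M x))) u
      = (CLINT x|lborel. cells_density I M x *\<^sub>R iexp (u * x))"
    unfolding char_def by (rule integral_density) (auto simp: cells_density_nonneg)
  then show ?thesis using has_integral_cells_density_iexp[OF assms, of u]
    by (simp only: has_bochner_integral_integral_eq)
qed

lemma real_distribution_cells_density:
  assumes "finite I" "I \<noteq> {}" "M > 0"
  shows "real_distribution (density lborel (\<lambda>x. ennreal (cells_density I M x)))"
proof -
  have "has_bochner_integral lborel (\<lambda>x. cells_density I M x *\<^sub>R (1::complex)) 1"
    using has_integral_cells_density_iexp[OF assms(1,3), of 0] assms
    by (simp add: unit_char_def)
  then have "has_bochner_integral lborel (\<lambda>x. Re (cells_density I M x *\<^sub>R (1::complex))) (Re 1)"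
    by (rule has_bochner_integral_bounded_linear[OF bounded_linear_Re])
  then have int: "has_bochner_integral lborel (cells_density I M) 1" by simp
  have "(\<integral>\<^sup>+x. ennreal (cells_density I M x) \<partial>lborel) = 1"
    using int cells_density_nonneg
    by (subst nn_integral_eq_integral) (auto simp: has_bochner_integral_iff)
  then show ?thesis
    by (intro real_distribution.intro prob_spaceI real_distribution_axioms.intro)
      (simp_all add: emeasure_density)
qed

lemma AE_cells_density:
  assumes "I \<subseteq> {..<M}"
  shows "AE x in density lborel (\<lambda>x. ennreal (cells_density I M x)). x \<in> {0..1}"
proof -
  have "cells_density I M x = 0" if "x \<notin> {0..1}" for x
    unfolding cells_density_def
  proof (rule sum.neutral, rule ballI)
    fix m assume "m \<in> I"
    then have "m + 1 \<le> M" using assms by auto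
    then have "real m + 1 \<le> real M" by linarith
    then have "real m / real M + inverse (real M) \<le> 1"
      by (simp add: field_simps)
    then have "x \<notin> {real m / real M..real m / real M + inverse (real M)}"
      using that by (auto intro: order_trans[of 0 "real m / real M"])
    then show "inverse (real (card I)) * real M *
        indicator {real m / real M..real m / real M + inverse (real M)} x = 0" by simp
  qed
  then have "0 < ennreal (cells_density I M x) \<longrightarrow> x \<in> {0..1}" for x by fastforce
  then show ?thesis by (subst AE_density) (auto intro!: AE_I2 simp del: atLeastAtMost_iff)
qed

lemma cantor_density_tree_choice:
  assumes "cantor_tree N t I" "N > 0"
  shows "cantor_density N t (tree_choice N I) j = cells_density (I j) (cantor_M N j)"
  unfolding cantor_density_def cantor_A_tree_choice[OF assms] cells_density_def
    cantor_tree_card[OF assms]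
  by (subst sum.reindex) (auto intro: inj_on_div_cantor_M assms(2))

text \<open>The characteristic function of the density of generation \<open>j\<close>, in closed form.\<close>

definition tree_char :: "nat \<Rightarrow> nat \<Rightarrow> (nat \<Rightarrow> nat set) \<Rightarrow> nat \<Rightarrow> real \<Rightarrow> complex" where
  "tree_char N t I j u = unit_char (u / real (cantor_M N j)) *
     (\<Sum>m\<in>I j. cis (u * real m / real (cantor_M N j))) / cantor_T N t j"

text \<open>The density of generation \<open>0\<close> is uniform on the unit interval, so its nonzero integer frequencies
  vanish.\<close>

lemma tree_char_0:
  assumes "cantor_tree N t I" "k \<noteq> 0"
  shows "tree_char N t I 0 (2 * pi * real_of_int k) = 0"
proof -
  define v where "v = 2 * pi * real_of_int k / 2 ^ N"
  have "tree_char N t I 0 (2 * pi * real_of_int k) = unit_char (real (2 ^ N) * v)"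
    unfolding tree_char_def cantor_tree_0[OF assms(1)]
    by (subst unit_char_refine) (simp_all add: v_def cantor_M_def cantor_T_def mult_ac)
  also have "real (2 ^ N) * v = 2 * pi * real_of_int k" by (simp add: v_def)
  also have "unit_char (2 * pi * real_of_int k) = 0"
    using assms(2) by (simp add: unit_char_def cis_multiple_2pi)
  finally show ?thesis .
qed

text \<open>Refining the density of generation \<open>j\<close> into all children does not change it. Both characteristic
  functions are therefore exponential sums on the grid of generation \<open>j + 1\<close> with the same smoothing
  factor, and their difference is that factor times the normalised refinement error.\<close>

lemma tree_char_Suc:
  assumes "cantor_tree N t I" "N > 0" "t > 0"
  shows "tree_char N t I (Suc j) u - tree_char N t I j u =
     unit_char (u / real (cantor_M N (Suc j))) * refinement_error N t I j u / cantor_T N t j"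
proof -
  define v where "v = u / real (cantor_M N (Suc j))"
  define S where "S = (\<Sum>m\<in>I j. cis (u * real m / real (cantor_M N j)))"
  define R where "R = (\<Sum>x\<in>I (Suc j). cis (u * real x / real (cantor_M N (Suc j))))"
  have "u * real (N * m + i) / real (cantor_M N (Suc j))
      = u * real m / real (cantor_M N j) + real i * v" for m i
    using assms(2) by (simp add: v_def cantor_M_Suc distrib_left add_divide_distrib mult_ac)
  then have "cis (u * real (N * m + i) / real (cantor_M N (Suc j)))
      = cis (u * real m / real (cantor_M N j)) * cis (real i * v)" for m i
    by (simp only: cis_mult)
  then have fine: "(\<Sum>m\<in>I j. \<Sum>i<N. cis (u * real (N * m + i) / real (cantor_M N (Suc j))))
      = S * (\<Sum>i<N. cis (real i * v))"
    unfolding S_def sum_product by simp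
  have "u / real (cantor_M N j) = real N * v" using assms(2) by (simp add: v_def cantor_M_Suc)
  then have "tree_char N t I j u
      = unit_char v * (S * (\<Sum>i<N. cis (real i * v)) / N) / cantor_T N t j"
    by (simp add: tree_char_def S_def unit_char_refine[OF assms(2)])
  moreover have "tree_char N t I (Suc j) u = unit_char v * (R / t) / cantor_T N t j"
    by (simp add: tree_char_def R_def v_def cantor_T_Suc)
  ultimately show ?thesis
    unfolding refinement_error_def fine R_def[symmetric] v_def[symmetric]
    by (simp add: right_diff_distrib diff_divide_distrib)
qed

lemma convergent_tree_char:
  assumes "cantor_tree N t I" "N \<ge> 2" "t > 0"
  shows "convergent (\<lambda>j. tree_char N t I j u)"
proof -
  have N: "N > 0" using assms by simp
  have T: "real (cantor_T N t j) > 0" for j using assms(3) by (simp add: cantor_T_def)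
  have bound: "cmod (tree_char N t I (Suc j) u - tree_char N t I j u) \<le> 2 * \<bar>u\<bar> * (1 / 2) ^ j" for j
  proof -
    have "cmod (tree_char N t I (Suc j) u - tree_char N t I j u)
        \<le> 1 * (2 * \<bar>u\<bar> * real (cantor_T N t j) / real (cantor_M N j)) / real (cantor_T N t j)"
      unfolding tree_char_Suc[OF assms(1) N assms(3)] norm_divide norm_mult norm_of_nat
      by (intro divide_right_mono mult_mono cmod_unit_char_le_1
          refinement_error_trivial_bound assms N) auto
    also have "\<dots> = 2 * \<bar>u\<bar> * (1 / real (cantor_M N j))" using T[of j] by simp
    also have "1 / real (cantor_M N j) \<le> (1 / 2) ^ j"
    proof -
      have "(2::nat) ^ j \<le> N ^ j" using assms(2) by (intro power_mono) auto
      also have "\<dots> \<le> cantor_M N j" by (simp add: cantor_M_def)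
      finally have "real (2 ^ j) \<le> real (cantor_M N j)" by (rule of_nat_mono)
      then show ?thesis by (simp add: power_one_over frac_le)
    qed
    finally show ?thesis by (simp add: mult_left_mono)
  qed
  have "summable (\<lambda>j. tree_char N t I (Suc j) u - tree_char N t I j u)"
    by (rule summable_comparison_test'[where N = 0, OF _ bound]) (auto intro: summable_mult summable_geometric)
  then have "convergent (\<lambda>n. \<Sum>j<n. tree_char N t I (Suc j) u - tree_char N t I j u)"
    by (simp add: summable_iff_convergent)
  then have "convergent (\<lambda>n. (tree_char N t I n u - tree_char N t I 0 u) + tree_char N t I 0 u)"
    unfolding sum_lessThan_telescope[of "\<lambda>j. tree_char N t I j u"] by (intro convergent_add convergent_const)
  then show ?thesis by simp
qed

section \<open>The limit measure\<close>

text \<open>Tightness gives a subsequential weak limit \<open>\<sigma>\<close>. Pointwise convergence of the characteristic functions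
  forces their limit to be the one of \<open>\<sigma>\<close>, and Levy's continuity theorem then gives convergence of the
  whole sequence.\<close>

lemma weak_limit_on_unit_interval:
  fixes \<mu> :: "nat \<Rightarrow> real measure"
  assumes distr: "\<And>n. real_distribution (\<mu> n)"
    and supp: "\<And>n. AE x in \<mu> n. x \<in> {0..1}"
    and conv: "\<And>u. convergent (\<lambda>n. char (\<mu> n) u)"
  shows "\<exists>\<sigma>. real_distribution \<sigma> \<and> weak_conv_m \<mu> \<sigma> \<and> (AE x in \<sigma>. x \<in> {0..1})"
proof -
  interpret \<mu>: real_distribution "\<mu> n" for n by (rule distr)
  have mass: "measure (\<mu> n) {-1<..1} = 1" for n
    using supp[of n] by (subst \<mu>.prob_eq_1) (auto elim!: eventually_mono)
  have "tight \<mu>"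
    unfolding tight_def using distr mass by (intro conjI allI impI exI[of _ "-1"] exI[of _ 1]) auto
  then obtain r \<sigma> where r: "strict_mono (r :: nat \<Rightarrow> nat)" and \<sigma>: "real_distribution \<sigma>"
    and w: "weak_conv_m (\<mu> \<circ> id \<circ> r) \<sigma>"
    using tight_imp_convergent_subsubsequence[of \<mu> id] strict_mono_id by blast
  interpret \<sigma>: real_distribution \<sigma> by (rule \<sigma>)
  have "(\<lambda>n. char (\<mu> n) u) \<longlonglongrightarrow> char \<sigma> u" for u
  proof -
    obtain L where L: "(\<lambda>n. char (\<mu> n) u) \<longlonglongrightarrow> L" using conv by (auto simp: convergent_def)
    then have "(\<lambda>n. char (\<mu> (r n)) u) \<longlonglongrightarrow> L"
      using LIMSEQ_subseq_LIMSEQ[OF L r] by (simp add: o_def)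
    moreover have "(\<lambda>n. char ((\<mu> \<circ> id \<circ> r) n) u) \<longlonglongrightarrow> char \<sigma> u"
      by (rule levy_continuity1[OF _ \<sigma> w]) (simp add: distr)
    ultimately have "L = char \<sigma> u" by (auto intro: LIMSEQ_unique)
    then show ?thesis using L by simp
  qed
  then have weak: "weak_conv_m \<mu> \<sigma>" by (intro levy_continuity distr \<sigma>)
  \<comment> \<open>A bounded continuous function whose zero set is the unit interval.\<close>
  define f :: "real \<Rightarrow> real" where "f x = min 1 (max 0 (max (- x) (x - 1)))" for x
  have f_cont: "isCont f x" for x unfolding f_def by (intro continuous_intros)
  have f_meas [measurable]: "f \<in> borel_measurable borel" unfolding f_def by measurable
  have f_bdd: "norm (f x) \<le> 1" for x by (simp add: f_def)
  have f0: "f x = 0 \<longleftrightarrow> x \<in> {0..1}" for x by (auto simp: f_def min_def max_def)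
  have "(\<lambda>n. integral\<^sup>L (\<mu> n) f) \<longlonglongrightarrow> integral\<^sup>L \<sigma> f"
    by (rule weak_conv_imp_integral_bdd_continuous_conv[OF distr \<sigma> weak f_cont f_bdd])
  moreover have "integral\<^sup>L (\<mu> n) f = 0" for n
  proof -
    have "integral\<^sup>L (\<mu> n) f = integral\<^sup>L (\<mu> n) (\<lambda>_. 0)"
      by (rule integral_cong_AE) (use supp[of n] f0 in auto)
    then show ?thesis by simp
  qed
  ultimately have "integral\<^sup>L \<sigma> f = 0" by (simp add: LIMSEQ_const_iff)
  moreover have "integrable \<sigma> f"
    by (rule \<sigma>.integrable_const_bound[where B = 1]) (use f_bdd in auto)
  moreover have "AE x in \<sigma>. 0 \<le> f x" by (auto simp: f_def)
  ultimately have "AE x in \<sigma>. f x = 0" by (simp add: integral_nonneg_eq_0_iff_AE)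
  then have "AE x in \<sigma>. x \<in> {0..1}" by (simp only: f0)
  then show ?thesis using \<sigma> weak by blast
qed

text \<open>The Fourier coefficient integrates over the unit interval only, the characteristic function over the
  whole line; they agree because the measure has no mass outside.\<close>

lemma fourier_coeff_eq_char:
  assumes "real_distribution \<sigma>" "AE x in \<sigma>. x \<in> {0..1}"
  shows "fourier_coeff \<sigma> k = char \<sigma> (2 * pi * real_of_int (- k))"
proof -
  interpret real_distribution \<sigma> by fact
  show ?thesis
    unfolding fourier_coeff_def char_def set_lebesgue_integral_def
  proof (rule integral_cong_AE)
    show "AE x in \<sigma>. indicat_real {0..1} x *\<^sub>R
        exp (- 2 * complex_of_real pi * \<i> * of_int k * complex_of_real x)
        = iexp (2 * pi * real_of_int (- k) * x)"
      using assms(2) by eventually_elim (simp add: mult_ac)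
  qed measurable
qed

lemma cantor_measure_of_tree:
  assumes "cantor_tree N t I" "N \<ge> 2" "t > 0"
  shows "\<exists>\<sigma>. is_cantor_measure N t (tree_choice N I) \<sigma> \<and>
    (\<forall>k. (\<lambda>j. tree_char N t I j (2 * pi * real_of_int (- k))) \<longlonglongrightarrow> fourier_coeff \<sigma> k)"
proof -
  have N: "N > 0" using assms by simp
  define \<mu> where "\<mu> j = density lborel (\<lambda>x. ennreal (cells_density (I j) (cantor_M N j) x))" for j
  have fin: "finite (I j)" "I j \<noteq> {}" "I j \<subseteq> {..<cantor_M N j}" "cantor_M N j > 0" for j
    using cantor_tree_finite[OF assms(1) N, of j] cantor_tree_card[OF assms(1) N, of j]
      cantor_tree_subset[OF assms(1) N, of j] cantor_M_pos[OF N, of j] assms(3)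
    by (auto simp: cantor_T_def)
  have char: "char (\<mu> j) u = tree_char N t I j u" for j u
    unfolding \<mu>_def tree_char_def char_cells_density[OF fin(1,4)] cantor_tree_card[OF assms(1) N] ..
  have distr: "real_distribution (\<mu> j)" for j
    unfolding \<mu>_def by (intro real_distribution_cells_density fin)
  have "\<exists>\<sigma>. real_distribution \<sigma> \<and> weak_conv_m \<mu> \<sigma> \<and> (AE x in \<sigma>. x \<in> {0..1})"
  proof (rule weak_limit_on_unit_interval[OF distr])
    show "AE x in \<mu> n. x \<in> {0..1}" for n unfolding \<mu>_def by (rule AE_cells_density[OF fin(3)])
    show "convergent (\<lambda>n. char (\<mu> n) u)" for u
      unfolding char by (rule convergent_tree_char[OF assms])
  qed
  then obtain \<sigma> where \<sigma>: "real_distribution \<sigma>" "weak_conv_m \<mu> \<sigma>" "AE x in \<sigma>. x \<in> {0..1}"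
    by blast
  have "is_cantor_measure N t (tree_choice N I) \<sigma>"
    unfolding is_cantor_measure_def cantor_density_tree_choice[OF assms(1) N]
    using \<sigma> by (simp add: \<mu>_def[abs_def])
  moreover have "(\<lambda>j. tree_char N t I j (2 * pi * real_of_int (- k))) \<longlonglongrightarrow> fourier_coeff \<sigma> k" for k
    using levy_continuity1[OF distr \<sigma>(1,2)] unfolding fourier_coeff_eq_char[OF \<sigma>(1,3)] char .
  ultimately show ?thesis by blast
qed

section \<open>Summing the increments\<close>

text \<open>The base scale \<open>2 ^ N\<close> beats every power of \<open>N\<close> because \<open>\<beta> < 1\<close>.\<close>

lemma base_term_eventually_small:
  assumes "C > 0" "\<beta> < 1"
  shows "\<forall>\<^sub>F N::nat in sequentially. 32 * sqrt (real N) * (2 powr real N) powr ((\<beta> - 1) / 2) * real N powr (\<beta> / 2) \<le> C"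
proof -
  define \<gamma> where "\<gamma> = (1 - \<beta>) / 2 * ln 2"
  have \<gamma>: "\<gamma> > 0" using assms(2) by (simp add: \<gamma>_def)
  have "((\<lambda>x::real. 32 * x * exp (- \<gamma> * x)) \<longlongrightarrow> 0) at_top"
    using \<gamma> by real_asymp
  then have "((\<lambda>n::nat. 32 * real n * exp (- \<gamma> * real n)) \<longlonglongrightarrow> 0)"
    using filterlim_compose filterlim_real_sequentially by blast
  then have "\<forall>\<^sub>F n::nat in sequentially. 32 * real n * exp (- \<gamma> * real n) < C"
    using assms(1) by (rule order_tendstoD)
  then show ?thesis using eventually_ge_at_top[of 1]
  proof eventually_elim
    case (elim n)
    have "(2 powr real n) powr ((\<beta> - 1) / 2) = exp (- \<gamma> * real n)"
      by (simp add: powr_def \<gamma>_def field_simps)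
    note K = this
    have "real n powr (\<beta> / 2) \<le> real n powr (1 / 2)"
      using elim assms(2) by (intro powr_mono) auto
    then have "sqrt (real n) * real n powr (\<beta> / 2) \<le> sqrt (real n) * sqrt (real n)"
      by (intro mult_left_mono) (simp_all add: powr_half_sqrt)
    then have "32 * exp (- \<gamma> * real n) * (sqrt (real n) * real n powr (\<beta> / 2))
        \<le> 32 * exp (- \<gamma> * real n) * real n"
      by (intro mult_left_mono) auto
    also have "\<dots> = 32 * real n * exp (- \<gamma> * real n)" by simp
    also have "\<dots> \<le> C" using elim(1) by linarith
    finally have "32 * exp (- \<gamma> * real n) * (sqrt (real n) * real n powr (\<beta> / 2)) \<le> C" .
    then show ?case unfolding K by (simp only: mult_ac)
  qed
qed

lemma ratio_eventually_small:
  assumes "\<beta> < \<alpha>"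
  shows "\<forall>\<^sub>F N::nat in sequentially. real N powr ((\<beta> - \<alpha>) / 2) \<le> 1 / 4"
proof -
  have "((\<lambda>x::real. x powr ((\<beta> - \<alpha>) / 2)) \<longlongrightarrow> 0) at_top"
    using assms by (intro tendsto_neg_powr filterlim_ident) auto
  then have "((\<lambda>n::nat. real n powr ((\<beta> - \<alpha>) / 2)) \<longlonglongrightarrow> 0)"
    using filterlim_compose filterlim_real_sequentially by blast
  then have "\<forall>\<^sub>F n::nat in sequentially. real n powr ((\<beta> - \<alpha>) / 2) < 1 / 4"
    by (rule order_tendstoD) simp
  then show ?thesis by (rule eventually_mono) simp
qed

lemma ln_cells_le:
  assumes "N \<ge> 1"
  shows "ln (4 * real (cantor_M N (Suc j))) \<le> 4 * real N * 4 ^ j"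
proof -
  have N: "real N \<ge> 1" using assms by simp
  have "ln (4 * real (cantor_M N (Suc j))) = ln 4 + (real N * ln 2 + real (Suc j) * ln (real N))"
    using N unfolding cantor_M_def
    by (simp add: ln_mult ln_realpow del: power_Suc of_nat_Suc)
  also have "\<dots> \<le> 2 + (real N * 1 + real (Suc j) * real N)"
  proof (intro add_mono mult_left_mono)
    have "ln (4::real) = 2 * ln 2" using ln_realpow[of 2 2] by simp
    then show "ln (4::real) \<le> 2" using ln_le_minus_one[of "2::real"] by simp
    show "ln (2::real) \<le> 1" using ln_le_minus_one[of "2::real"] by simp
    show "ln (real N) \<le> real N" using ln_le_minus_one[of "real N"] N by linarith
  qed auto
  also have "\<dots> \<le> real N * (4 + real j)" using N by (simp add: algebra_simps)
  also have "4 + real j \<le> 4 * 4 ^ j"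
  proof -
    have "1 + real j * 3 \<le> (1 + 3) ^ j" by (rule Bernoulli_inequality) simp
    then show ?thesis by simp
  qed
  finally show ?thesis using N by (simp add: mult_left_mono mult_ac)
qed

text \<open>The increment of generation \<open>j\<close> is of size \<open>M powr (\<beta> / 2) * sqrt (ln M / T)\<close> with \<open>M\<close> equal to
  \<open>2 ^ N * N ^ (j + 1)\<close> and \<open>T\<close> equal to \<open>2 ^ N * N powr (\<alpha> * j)\<close>. Passing from \<open>j\<close> to \<open>j + 1\<close> gains
  \<open>N powr ((\<beta> - \<alpha>) / 2)\<close>, at most \<open>1 / 4\<close>. A factor \<open>2 ^ j\<close> is spent to absorb the logarithm, which
  leaves the ratio \<open>1 / 2\<close>.\<close>

lemma increment_term_le:
  assumes "N \<ge> 1" "real t = real N powr \<alpha>"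
    and ratio: "real N powr ((\<beta> - \<alpha>) / 2) \<le> 1 / 4"
  shows "real (cantor_M N (Suc j)) powr (\<beta> / 2) *
      (8 * sqrt (real (cantor_T N t j) * ln (4 * real (cantor_M N (Suc j))))) / real (cantor_T N t j)
    \<le> 16 * sqrt (real N) * (2 powr real N) powr ((\<beta> - 1) / 2) * real N powr (\<beta> / 2) * (1 / 2) ^ j"
proof -
  have N: "real N \<ge> 1" using assms(1) by simp
  define K where "K = 2 powr real N"
  have K: "K > 0" by (simp add: K_def)
  define T where "T = real (cantor_T N t j)"
  have T: "T = K * real N powr (\<alpha> * real j)"
    using assms(2) N by (simp add: T_def cantor_T_def K_def powr_realpow powr_power mult.commute)
  have Tpos: "T > 0" using K N by (simp add: T)
  have M: "real (cantor_M N (Suc j)) = K * (real N * real N powr real j)"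
    using N by (simp add: cantor_M_def K_def powr_realpow)
  have "sqrt (T * ln (4 * real (cantor_M N (Suc j)))) \<le> sqrt (T * (4 * real N * 4 ^ j))"
    using ln_cells_le[OF assms(1)] Tpos by (intro real_sqrt_le_mono mult_left_mono) auto
  also have "\<dots> = 2 * 2 ^ j * sqrt (real N) * sqrt T"
  proof -
    have "sqrt (4 ^ j) = (2::real) ^ j" by (simp add: real_sqrt_power)
    then show ?thesis by (simp add: real_sqrt_mult mult_ac)
  qed
  finally have "sqrt (T * ln (4 * real (cantor_M N (Suc j)))) / T \<le> 2 * 2 ^ j * sqrt (real N) * sqrt T / T"
    using Tpos by (intro divide_right_mono) auto
  also have "sqrt T / T = T powr (- 1 / 2)"
    using Tpos powr_diff[of T "1 / 2" 1] by (simp add: powr_half_sqrt)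
  then have "2 * 2 ^ j * sqrt (real N) * sqrt T / T = 2 * 2 ^ j * sqrt (real N) * T powr (- 1 / 2)"
    by (metis times_divide_eq_right)
  finally have *: "sqrt (T * ln (4 * real (cantor_M N (Suc j)))) / T \<le> 2 * 2 ^ j * sqrt (real N) * T powr (- 1 / 2)" .
  have "real (cantor_M N (Suc j)) powr (\<beta> / 2) * T powr (- 1 / 2)
     = K powr ((\<beta> - 1) / 2) * real N powr (\<beta> / 2) * (real N powr ((\<beta> - \<alpha>) / 2)) ^ j"
  proof -
    have "real (cantor_M N (Suc j)) powr (\<beta> / 2) * T powr (- 1 / 2)
        = (K powr (\<beta> / 2) * K powr (- 1 / 2)) * real N powr (\<beta> / 2)
          * (real N powr (real j * (\<beta> / 2)) * real N powr (\<alpha> * real j * (- 1 / 2)))"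
      using K N by (simp add: M T powr_mult powr_powr mult_ac)
    also have "\<dots> = K powr ((\<beta> - 1) / 2) * real N powr (\<beta> / 2) * real N powr (((\<beta> - \<alpha>) / 2) * real j)"
      unfolding powr_add[symmetric] by (simp add: field_simps)
    also have "real N powr (((\<beta> - \<alpha>) / 2) * real j) = (real N powr ((\<beta> - \<alpha>) / 2)) ^ j"
    proof -
      have "(real N powr ((\<beta> - \<alpha>) / 2)) ^ j = (real N powr ((\<beta> - \<alpha>) / 2)) powr real j"
        using N by (intro powr_realpow[symmetric]) simp
      then show ?thesis by (simp only: powr_powr)
    qed
    finally show ?thesis .
  qed
  also have "\<dots> \<le> K powr ((\<beta> - 1) / 2) * real N powr (\<beta> / 2) * (1 / 4) ^ j"
    using ratio by (intro mult_left_mono power_mono) auto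
  finally have **: "real (cantor_M N (Suc j)) powr (\<beta> / 2) * T powr (- 1 / 2)
     \<le> K powr ((\<beta> - 1) / 2) * real N powr (\<beta> / 2) * (1 / 4) ^ j" .
  have "real (cantor_M N (Suc j)) powr (\<beta> / 2) *
      (8 * sqrt (T * ln (4 * real (cantor_M N (Suc j))))) / T
    = 8 * real (cantor_M N (Suc j)) powr (\<beta> / 2) * (sqrt (T * ln (4 * real (cantor_M N (Suc j)))) / T)"
    by simp
  also have "\<dots> \<le> 8 * real (cantor_M N (Suc j)) powr (\<beta> / 2) * (2 * 2 ^ j * sqrt (real N) * T powr (- 1 / 2))"
    using * by (intro mult_left_mono) auto
  also have "\<dots> = 16 * 2 ^ j * sqrt (real N) * (real (cantor_M N (Suc j)) powr (\<beta> / 2) * T powr (- 1 / 2))"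
    by simp
  also have "\<dots> \<le> 16 * 2 ^ j * sqrt (real N) * (K powr ((\<beta> - 1) / 2) * real N powr (\<beta> / 2) * (1 / 4) ^ j)"
    using ** by (intro mult_left_mono) auto
  also have "\<dots> = 16 * sqrt (real N) * K powr ((\<beta> - 1) / 2) * real N powr (\<beta> / 2) * (2 ^ j * (1 / 4) ^ j)"
    by simp
  also have "2 ^ j * (1 / 4) ^ j = (1 / 2 :: real) ^ j"
    by (simp flip: power_mult_distrib)
  finally show ?thesis unfolding T_def K_def .
qed

text \<open>Interpolation between the bounds \<open>1\<close> and \<open>y\<close>.\<close>

lemma min_1_le_powr:
  fixes z y :: real
  assumes "z \<le> 1" "z \<le> y" "y > 0" "0 \<le> s" "s \<le> 1"
  shows "z \<le> y powr s"
proof (cases "y \<ge> 1")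
  case True
  then show ?thesis using ge_one_powr_ge_zero[of y s] assms by linarith
next
  case False
  then have "y powr 1 \<le> y powr s" using assms by (intro powr_mono') auto
  then show ?thesis using assms by simp
qed

text \<open>The smoothing factor is at most \<open>min 1 (M / \<bar>k\<bar>)\<close>, hence at most \<open>(M / \<bar>k\<bar>) powr (\<beta> / 2)\<close>. The
  negative power of \<open>\<bar>k\<bar>\<close> is the required decay, and the power of \<open>M\<close> is paid for by cancellation.\<close>

lemma tree_char_increment_le:
  assumes tree: "cantor_tree N t I" and N: "N > 0" and t: "t > 0"
    and \<beta>: "0 < \<beta>" "\<beta> < 1" and k: "k \<noteq> 0"
    and err: "cmod (refinement_error N t I j (2 * pi * real_of_int k)) \<le> E"
  shows "cmod (tree_char N t I (Suc j) (2 * pi * real_of_int k) - tree_char N t I j (2 * pi * real_of_int k))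
    \<le> \<bar>real_of_int k\<bar> powr (- \<beta> / 2) *
       (real (cantor_M N (Suc j)) powr (\<beta> / 2) * E / real (cantor_T N t j))"
proof -
  define M where "M = real (cantor_M N (Suc j))"
  define v where "v = 2 * pi * real_of_int k / M"
  have M: "M > 0" using N by (simp add: M_def cantor_M_pos)
  have k1: "\<bar>real_of_int k\<bar> \<ge> 1" using k by linarith
  have "cmod (unit_char v) \<le> (M / \<bar>real_of_int k\<bar>) powr (\<beta> / 2)"
  proof (rule min_1_le_powr)
    show "cmod (unit_char v) \<le> M / \<bar>real_of_int k\<bar>"
    proof -
      have "cmod (unit_char v) \<le> 2 / \<bar>v\<bar>" using k M by (intro cmod_unit_char_le) (simp add: v_def)
      also have "2 / \<bar>v\<bar> = (M / \<bar>real_of_int k\<bar>) / pi" using M by (simp add: v_def abs_mult)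
      also have "\<dots> \<le> (M / \<bar>real_of_int k\<bar>) / 1"
        using M k1 pi_gt3 by (intro divide_left_mono) auto
      finally show ?thesis by simp
    qed
  qed (use M k1 \<beta> cmod_unit_char_le_1 in auto)
  also have "\<dots> = \<bar>real_of_int k\<bar> powr (- \<beta> / 2) * M powr (\<beta> / 2)"
    using M k1 by (simp add: powr_divide powr_minus_divide)
  finally have uc: "cmod (unit_char v) \<le> \<bar>real_of_int k\<bar> powr (- \<beta> / 2) * M powr (\<beta> / 2)" .
  have "cmod (tree_char N t I (Suc j) (2 * pi * real_of_int k) - tree_char N t I j (2 * pi * real_of_int k))
      \<le> (\<bar>real_of_int k\<bar> powr (- \<beta> / 2) * M powr (\<beta> / 2)) * E / real (cantor_T N t j)"
    unfolding tree_char_Suc[OF tree N t] norm_divide norm_mult norm_of_nat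
      M_def[symmetric] v_def[symmetric]
    by (intro divide_right_mono mult_mono uc err) auto
  then show ?thesis by (simp add: M_def mult_ac)
qed

lemma exists_cantor_measure_with_fourier_decay:
  assumes t: "1 \<le> t" "t \<le> N" and tN: "real t = real N powr \<alpha>" and N: "N \<ge> 2"
    and \<beta>: "0 < \<beta>" "\<beta> < 1"
    and base: "32 * sqrt (real N) * (2 powr real N) powr ((\<beta> - 1) / 2) * real N powr (\<beta> / 2) \<le> C"
    and ratio: "real N powr ((\<beta> - \<alpha>) / 2) \<le> 1 / 4"
  shows "\<exists>B. cantor_choice N t B \<and> (\<exists>\<sigma>. is_cantor_measure N t B \<sigma> \<and>
     (\<forall>k::int. k \<noteq> 0 \<longrightarrow> cmod (fourier_coeff \<sigma> k) \<le> C * \<bar>real_of_int k\<bar> powr (- \<beta> / 2)))"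
proof -
  obtain I where tree: "cantor_tree N t I"
    and err: "\<And>j k. cmod (refinement_error N t I j (2 * pi * real_of_int k))
       \<le> 8 * sqrt (real (cantor_T N t j) * ln (4 * real (cantor_M N (Suc j))))"
    using cantor_tree_with_small_errors[OF t] by blast
  obtain \<sigma> where \<sigma>: "is_cantor_measure N t (tree_choice N I) \<sigma>"
    and lim: "\<And>k. (\<lambda>j. tree_char N t I j (2 * pi * real_of_int (- k))) \<longlonglongrightarrow> fourier_coeff \<sigma> k"
    using cantor_measure_of_tree[OF tree N] t by auto
  have "cmod (fourier_coeff \<sigma> k) \<le> C * \<bar>real_of_int k\<bar> powr (- \<beta> / 2)" if k: "k \<noteq> 0" for k
  proof (rule LIMSEQ_le_const2[OF tendsto_norm[OF lim]], intro exI allI impI)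
    fix n :: nat
    define c where "c j = tree_char N t I j (2 * pi * real_of_int (- k))" for j
    define D where "D = 16 * sqrt (real N) * (2 powr real N) powr ((\<beta> - 1) / 2) * real N powr (\<beta> / 2)"
    have step: "cmod (c (Suc j) - c j) \<le> \<bar>real_of_int k\<bar> powr (- \<beta> / 2) * (D * (1 / 2) ^ j)" for j
    proof -
      have "cmod (c (Suc j) - c j) \<le> \<bar>real_of_int (- k)\<bar> powr (- \<beta> / 2) *
        (real (cantor_M N (Suc j)) powr (\<beta> / 2) *
          (8 * sqrt (real (cantor_T N t j) * ln (4 * real (cantor_M N (Suc j))))) / real (cantor_T N t j))"
        unfolding c_def using k t N by (intro tree_char_increment_le tree \<beta> err) auto
      also have "\<dots> \<le> \<bar>real_of_int (- k)\<bar> powr (- \<beta> / 2) * (D * (1 / 2) ^ j)"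
        unfolding D_def using N by (intro mult_left_mono increment_term_le[OF _ tN ratio]) auto
      finally show ?thesis by simp
    qed
    have "c n = (\<Sum>j<n. c (Suc j) - c j)"
      using tree_char_0[OF tree, of "- k"] k by (simp add: sum_lessThan_telescope c_def[of 0])
    also have "cmod \<dots> \<le> (\<Sum>j<n. \<bar>real_of_int k\<bar> powr (- \<beta> / 2) * (D * (1 / 2) ^ j))"
      by (intro sum_norm_le step)
    also have "\<dots> = \<bar>real_of_int k\<bar> powr (- \<beta> / 2) * (D * (\<Sum>j<n. (1 / 2) ^ j))"
      by (simp add: sum_distrib_left)
    also have "\<dots> \<le> \<bar>real_of_int k\<bar> powr (- \<beta> / 2) * (D * 2)"
    proof (intro mult_left_mono)
      show "(\<Sum>j<n. (1 / 2) ^ j) \<le> (2::real)" by (simp add: geometric_sum)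
    qed (auto simp: D_def)
    also have "\<dots> \<le> \<bar>real_of_int k\<bar> powr (- \<beta> / 2) * C"
      using base by (intro mult_left_mono) (auto simp: D_def)
    finally show "cmod (tree_char N t I n (2 * pi * real_of_int (- k))) \<le> C * \<bar>real_of_int k\<bar> powr (- \<beta> / 2)"
      by (simp add: c_def mult.commute)
  qed
  then show ?thesis using \<sigma> cantor_choice_tree_choice[OF tree] N by auto
qed

lemma power_powr_log_ratio:
  assumes "\<alpha> = ln (real t\<^sub>0) / ln (real N\<^sub>0)" "\<alpha> > 0" "1 \<le> t\<^sub>0" "t\<^sub>0 \<le> N\<^sub>0"
  shows "real (t\<^sub>0 ^ n) = real (N\<^sub>0 ^ n) powr \<alpha>"
proof -
  have N: "real N\<^sub>0 > 0" using assms by simp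
  have "ln (real N\<^sub>0) \<noteq> 0" using assms by auto
  then have t: "real t\<^sub>0 = real N\<^sub>0 powr \<alpha>" using assms by (simp add: powr_def)
  have "real (t\<^sub>0 ^ n) = (real N\<^sub>0 powr \<alpha>) powr real n"
    using N by (simp add: t powr_realpow)
  also have "\<dots> = (real N\<^sub>0 powr real n) powr \<alpha>" by (simp add: powr_powr mult.commute)
  also have "\<dots> = real (N\<^sub>0 ^ n) powr \<alpha>" using N by (simp add: powr_realpow)
  finally show ?thesis .
qed

theorem lemma6p5:
  fixes C\<^sub>2 \<alpha> \<beta> :: real
  assumes "C\<^sub>2 > 0" and "0 < \<beta>" and "\<beta> < \<alpha>" and "\<alpha> < 1"
  shows "\<exists>Nstar::nat. \<forall>N\<^sub>0 t\<^sub>0 n :: nat.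
           1 \<le> t\<^sub>0 \<longrightarrow> t\<^sub>0 \<le> N\<^sub>0 \<longrightarrow> \<alpha> = ln (real t\<^sub>0) / ln (real N\<^sub>0) \<longrightarrow>
           1 \<le> n \<longrightarrow> Nstar \<le> N\<^sub>0 ^ n \<longrightarrow>
           (\<exists>B. cantor_choice (N\<^sub>0 ^ n) (t\<^sub>0 ^ n) B \<and>
              (\<exists>\<sigma>. is_cantor_measure (N\<^sub>0 ^ n) (t\<^sub>0 ^ n) B \<sigma> \<and>
                 (\<forall>k::int. k \<noteq> 0 \<longrightarrow>
                    cmod (fourier_coeff \<sigma> k) \<le> C\<^sub>2 * \<bar>real_of_int k\<bar> powr (- \<beta> / 2))))"
proof -
  have "\<beta> < 1" using assms by simp
  from eventually_conj[OF base_term_eventually_small[OF assms(1) this]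
      eventually_conj[OF ratio_eventually_small[OF assms(3)] eventually_ge_at_top[of 2]]]
  obtain Nstar :: nat where Nstar: "\<And>N. N \<ge> Nstar \<Longrightarrow>
      32 * sqrt (real N) * (2 powr real N) powr ((\<beta> - 1) / 2) * real N powr (\<beta> / 2) \<le> C\<^sub>2 \<and>
      real N powr ((\<beta> - \<alpha>) / 2) \<le> 1 / 4 \<and> N \<ge> 2"
    unfolding eventually_sequentially by blast
  show ?thesis
  proof (intro exI[of _ Nstar] allI impI, rule exists_cantor_measure_with_fourier_decay)
    fix N\<^sub>0 t\<^sub>0 n :: nat
    assume *: "1 \<le> t\<^sub>0" "t\<^sub>0 \<le> N\<^sub>0" "\<alpha> = ln (real t\<^sub>0) / ln (real N\<^sub>0)" "1 \<le> n" "Nstar \<le> N\<^sub>0 ^ n"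
    show "real (t\<^sub>0 ^ n) = real (N\<^sub>0 ^ n) powr \<alpha>"
      using * assms by (intro power_powr_log_ratio) auto
    show "1 \<le> t\<^sub>0 ^ n" "t\<^sub>0 ^ n \<le> N\<^sub>0 ^ n" using * by (auto intro: power_mono)
    show "32 * sqrt (real (N\<^sub>0 ^ n)) * (2 powr real (N\<^sub>0 ^ n)) powr ((\<beta> - 1) / 2)
        * real (N\<^sub>0 ^ n) powr (\<beta> / 2) \<le> C\<^sub>2"
      "real (N\<^sub>0 ^ n) powr ((\<beta> - \<alpha>) / 2) \<le> 1 / 4" "2 \<le> N\<^sub>0 ^ n"
      using Nstar[OF *(5)] by blast+
  qed (use assms in auto)
qed

end
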